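(* Let $q\in(0,1)$. If $f(z)=z+\sum_{n=2}^\infty a_nz^n$ belongs to $\mathcal{K}_q$, then $$|a_n|\le\frac{1-q}{1-q^n}\left[n+\frac{n(n-1)}{2}(1+q)\right]\quad\text{for all } n\ge 2 .$$
   Context: $\mathbb{D}=\{z\in\mathbb{C}:|z|<1\}$. $\mathcal{A}$ is the class of functions $f$ analytic in $\mathbb{D}$ with $f(0)=0=f'(0)-1$. $\mathcal{S}^*\subset\mathcal{A}$ is the class of univalent functions $g\in\mathcal{A}$ that are starlike with respect to the origin ($tw\in g(\mathbb{D})$ whenever $t\in[0,1]$, $w\in g(\mathbb{D})$). For $q\in(0,1)$ and $f\in\mathcal{A}$, the $q$-difference operator is $(D_qf)(z)=\dfrac{f(z)-f(qz)}{z(1-q)}$ for $z\in\mathbb{D}\setminus\{0\}$, and $(D_qf)(0)=f'(0)$. A function $f\in\mathcal{A}$ belongs to $\mathcal{K}_q$ ($q$-close-to-convex functions) if there exists $g\in\mathcal{S}^*$ such that $$\left|\frac{z}{g(z)}(D_qf)(z)-\frac{1}{1-q}\right|\le\frac{1}{1-q},\quad z\in\mathbb{D}$$ (where $z/g(z)$ is given its limit value $1$ at $z=0$). *)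

theory Defs
  imports "HOL-Complex_Analysis.Complex_Analysis"
begin

text \<open>
  Functions on the unit disc are total functions on \<^typ>\<open>complex\<close>; only their values on
  \<^term>\<open>ball (0::complex) 1\<close> matter in the definitions below.
\<close>

definition class_A :: "(complex \<Rightarrow> complex) set" where
  "class_A = {f. f analytic_on ball 0 1 \<and> f 0 = 0 \<and> deriv f 0 - 1 = 0}"

definition starlike_wrt_origin :: "complex set \<Rightarrow> bool" where
  "starlike_wrt_origin S \<longleftrightarrow> (\<forall>t\<in>{0..1::real}. \<forall>w\<in>S. of_real t * w \<in> S)"

definition class_S_star :: "(complex \<Rightarrow> complex) set" where
  "class_S_star = {g \<in> class_A. inj_on g (ball 0 1) \<and> starlike_wrt_origin (g ` ball 0 1)}"

definition q_difference :: "real \<Rightarrow> (complex \<Rightarrow> complex) \<Rightarrow> complex \<Rightarrow> complex" where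
  "q_difference q f z =
     (if z = 0 then deriv f 0
      else (f z - f (of_real q * z)) / (z * (1 - of_real q)))"

text \<open>
  The quotient \<open>z / g z\<close> has a removable singularity at the origin with limit
  \<open>1 / g'(0) = 1\<close>; the limit has to be inserted by hand because \<open>0 / 0 = 0\<close> in HOL.
\<close>

definition id_over :: "(complex \<Rightarrow> complex) \<Rightarrow> complex \<Rightarrow> complex" where
  "id_over g z = (if z = 0 then 1 else z / g z)"

definition class_K :: "real \<Rightarrow> (complex \<Rightarrow> complex) set" where
  "class_K q = {f \<in> class_A. \<exists>g\<in>class_S_star. \<forall>z\<in>ball 0 1.
     norm (id_over g z * q_difference q f z - 1 / (1 - of_real q)) \<le> 1 / (1 - q)}"

end

theory Submission
  imports Defs
begin

text \<open>
  Write \<open>g\<close> for the starlike function that witnesses \<open>f \<in> class_K q\<close>, and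
  \<open>p z = z / g z * q_difference q f z\<close>. Then \<open>z * q_difference q f z = g z * p z\<close>, and since
  the operator multiplies the \<open>n\<close>-th coefficient by \<open>(1 - q^n) / (1 - q)\<close>, comparing
  coefficients gives
  \<open>(1 - q^n) / (1 - q) * a\<^sub>n = b\<^sub>n + (\<Sum>k<n. b\<^sub>k * p\<^sub>n\<^sub>-\<^sub>k)\<close>,
  where \<open>b\<^sub>k\<close> and \<open>p\<^sub>m\<close> are the Taylor coefficients of \<open>g\<close> and \<open>p\<close>. The theorem follows from
  the two bounds \<open>norm b\<^sub>k \<le> k\<close> and \<open>norm p\<^sub>m \<le> 1 + q\<close> for \<open>m > 0\<close>.

  The second bound (\<open>fps_coeff_bound_subordinate\<close>) is the case of a disc of Rogosinski's theorem on
  coefficients of functions subordinate to a convex map: \<open>p\<close> takes the value \<open>1\<close> at \<open>0\<close> and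
  stays in the disc of centre and radius \<open>1 / (1 - q)\<close>, that is,
  \<open>(1 - q) * (norm p)^2 \<le> 2 * Re p\<close>. In this form \<open>q = 1\<close> makes sense too: the disc becomes the
  right half plane and the bound becomes Caratheodory's \<open>norm p\<^sub>m \<le> 2\<close>.

  This limiting case also yields the first bound, which is Nevanlinna's theorem
  (\<open>class_S_star_coeff_bound\<close>). The geometric definition of starlikeness implies that
  \<open>z * deriv g z / g z\<close> has nonnegative real part (\<open>starlike_Re_nonneg\<close>), and the same comparison
  of coefficients in \<open>z * deriv g z = g z * (z * deriv g z / g z)\<close> bounds \<open>b\<^sub>n\<close> by induction.
\<close>

section \<open>Power series on the unit disc\<close>

lemma fps_expansion_mult_eq:
  assumes "f holomorphic_on ball 0 1" "g holomorphic_on ball 0 1"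
    and "\<And>z. z \<in> ball 0 1 \<Longrightarrow> F z = f z * g z"
  shows "fps_expansion F 0 = fps_expansion f 0 * fps_expansion g 0"
proof -
  have "f has_fps_expansion fps_expansion f 0" "g has_fps_expansion fps_expansion g 0"
    using assms(1,2) by (auto intro!: has_fps_expansion_fps_expansion[of "ball 0 1"])
  then have "(\<lambda>z. f z * g z) has_fps_expansion fps_expansion f 0 * fps_expansion g 0"
    by (rule has_fps_expansion_mult)
  moreover have "eventually (\<lambda>z. F z = f z * g z) (nhds 0)"
    using eventually_nhds_in_open[of "ball 0 1" "0::complex"] assms(3)
    by (auto elim!: eventually_mono)
  ultimately have "F has_fps_expansion fps_expansion f 0 * fps_expansion g 0"
    using has_fps_expansion_cong[of F "\<lambda>z. f z * g z"] by blast
  then show ?thesis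
    by (rule fps_expansion_eqI)
qed

text \<open>Cauchy's estimate on the circles of radius \<open>r < 1\<close>, in the limit \<open>r \<rightarrow> 1\<close>.\<close>

lemma fps_coeff_le_1_if_bounded_by_1:
  assumes holo: "F holomorphic_on ball 0 1" and bound: "\<And>z. z \<in> ball 0 1 \<Longrightarrow> norm (F z) \<le> 1"
  shows "norm (fps_nth (fps_expansion F 0) n) \<le> 1"
proof -
  define c where "c = fps_nth (fps_expansion F 0) n"
  have "norm c * r ^ n \<le> 1" if r: "0 < r" "r < 1" for r
  proof -
    have "F holomorphic_on cball 0 r"
      using holo by (rule holomorphic_on_subset) (use r in auto)
    then have "norm ((deriv ^^ n) F 0) \<le> fact n * 1 / r ^ n"
      by (intro Cauchy_inequality)
         (use r in \<open>auto intro!: bound holomorphic_on_imp_continuous_on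
            intro: holomorphic_on_subset\<close>)
    then show ?thesis
      using r by (simp add: c_def fps_expansion_def norm_divide field_simps)
  qed
  then have "eventually (\<lambda>r. norm c * r ^ n \<le> 1) (at_left 1)"
    by (auto simp: eventually_at_left[of 0] intro!: exI[of _ 0])
  moreover have "((\<lambda>r. norm c * r ^ n) \<longlongrightarrow> norm c * 1 ^ n) (at_left 1)"
    by (intro tendsto_intros)
  ultimately show ?thesis
    unfolding c_def using tendsto_upperbound[of _ _ "at_left (1::real)" 1] by fastforce
qed

lemma has_fps_expansion_if_sums:
  fixes f :: "complex \<Rightarrow> complex"
  assumes "\<And>z. z \<in> ball 0 1 \<Longrightarrow> (\<lambda>n. s n * z ^ n) sums f z"
  shows "f has_fps_expansion Abs_fps s"
proof -
  have "summable (\<lambda>n. s n * (1/2) ^ n)"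
    using assms[of "1/2"] by (auto simp: sums_iff)
  then have "conv_radius s \<ge> norm (1/2 :: complex)"
    by (rule conv_radius_geI)
  moreover have "(0::ereal) < norm (1/2 :: complex)"
    by simp
  ultimately have "fps_conv_radius (Abs_fps s) > 0"
    unfolding fps_conv_radius_def fps_nth_Abs_fps by (rule less_le_trans[rotated])
  moreover have "eventually (\<lambda>z. eval_fps (Abs_fps s) z = f z) (nhds 0)"
    using eventually_nhds_in_open[of "ball 0 1" "0::complex"] assms
    by (auto elim!: eventually_mono simp: eval_fps_def sums_iff)
  ultimately show ?thesis
    by (simp add: has_fps_expansion_def)
qed

text \<open>
  The triangle inequality for the Cauchy product. The top term \<open>B\<^sub>n * P\<^sub>0\<close> is moved to the left-hand
  side: \<open>B\<^sub>n\<close> is then estimated separately, or, when \<open>(B * P)\<^sub>n = n * B\<^sub>n\<close>, absorbed to give a recursive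
  bound for \<open>B\<^sub>n\<close> from the lower coefficients alone.
\<close>

lemma fps_mult_coeff_bound:
  fixes B P :: "complex fps"
  assumes P0: "fps_nth P 0 = 1" and P: "\<And>m. m > 0 \<Longrightarrow> norm (fps_nth P m) \<le> c"
    and B: "\<And>k. k < n \<Longrightarrow> norm (fps_nth B k) \<le> real k"
  shows "norm (fps_nth (B * P) n - fps_nth B n) \<le> c * (real n * (real n - 1) / 2)"
proof -
  have "fps_nth (B * P) n - fps_nth B n = (\<Sum>k<n. fps_nth B k * fps_nth P (n - k))"
    by (simp add: fps_mult_nth P0 atLeast0AtMost flip: lessThan_Suc_atMost)
  also have "norm \<dots> \<le> (\<Sum>k<n. real k * c)"
    by (intro sum_norm_le) (auto simp: norm_mult intro!: mult_mono P B)
  also have "\<dots> = c * (\<Sum>k<n. real k)"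
    by (simp add: sum_distrib_left mult.commute)
  also have "(\<Sum>k<n. real k) = real n * (real n - 1) / 2"
    by (induction n) (auto simp: field_simps)
  finally show ?thesis .
qed

section \<open>Coefficients of functions with values in a disc or half plane\<close>

text \<open>
  The filter that keeps exactly the coefficients of a power series whose index is divisible by \<open>n\<close>.
\<close>

lemma roots_of_unity_average:
  fixes n j :: nat
  assumes "n > 0"
  defines "\<omega> \<equiv> exp (2 * of_real pi * \<i> / of_nat n)"
  shows "(\<Sum>k<n. (\<omega> ^ k) ^ j) / of_nat n = (if n dvd j then 1 else 0)"
proof -
  have pw: "\<omega> ^ j = exp (2 * of_real pi * \<i> * of_nat j / of_nat n)"
    by (simp add: \<omega>_def exp_of_nat_mult [symmetric] field_simps)
  have 1: "\<omega> ^ n = 1"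
    using assms by (simp add: \<omega>_def exp_of_nat_mult [symmetric])
  have "(\<Sum>k<n. (\<omega> ^ k) ^ j) = (\<Sum>k<n. (\<omega> ^ j) ^ k)"
    by (simp add: power_mult [symmetric] mult.commute)
  moreover have "(\<omega> ^ j) ^ n = 1"
    using 1 by (metis power_mult mult.commute power_one)
  moreover have "\<omega> ^ j = 1 \<longleftrightarrow> n dvd j"
    unfolding pw using complex_root_unity_eq_1[of n j] assms(1) by simp
  ultimately show ?thesis
    using assms(1) by (simp add: sum_gp_strict)
qed

text \<open>
  For \<open>q < 1\<close> the hypothesis says that \<open>p z\<close> lies in the closed disc of centre and radius
  \<open>1 / (1 - q)\<close>, for \<open>q = 1\<close> that it lies in the closed right half plane. Both sets are convex, so
  averaging \<open>p\<close> over the rotations by \<open>n\<close>-th roots of unity preserves the hypothesis. The average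
  \<open>P\<close> has the expansion \<open>1 + p\<^sub>n z\<^sup>n + \<dots>\<close>. The Moebius map \<open>w \<mapsto> (w - 1) / (q * w + 1)\<close> sends
  the convex set into the unit disc, with \<open>1 \<mapsto> 0\<close> and derivative \<open>1 / (1 + q)\<close> at \<open>1\<close>; since \<open>P\<close>
  has no terms between the constant one and the \<open>n\<close>-th, the \<open>n\<close>-th coefficient of the composition is
  \<open>p\<^sub>n / (1 + q)\<close>, and Cauchy's estimate applies to it.
\<close>

lemma fps_coeff_bound_subordinate:
  fixes p :: "complex \<Rightarrow> complex" and q :: real
  assumes q: "0 \<le> q" "q \<le> 1"
    and holo: "p holomorphic_on ball 0 1" and p0: "p 0 = 1"
    and range: "\<And>z. z \<in> ball 0 1 \<Longrightarrow> (1 - q) * norm (p z) ^ 2 \<le> 2 * Re (p z)"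
    and n: "n > 0"
  shows "norm (fps_nth (fps_expansion p 0) n) \<le> 1 + q"
proof -
  define \<omega> :: complex where "\<omega> = exp (2 * of_real pi * \<i> / of_nat n)"
  have norm\<omega>: "norm \<omega> = 1"
    by (simp add: \<omega>_def)
  define P where "P = (\<lambda>z. (\<Sum>k<n. p (\<omega> ^ k * z)) / of_nat n)"
  define A where "A = fps_expansion p 0"
  define B where "B = Abs_fps (\<lambda>j. if n dvd j then fps_nth A j else 0)"
  have rot: "\<omega> ^ k * z \<in> ball 0 1" if "z \<in> ball 0 1" for k z
    using that by (simp add: norm_mult norm_power norm\<omega>)
  have P_holo: "P holomorphic_on ball 0 1"
    unfolding P_def
    by (intro holomorphic_intros holomorphic_on_compose_gen[OF _ holo, unfolded o_def])
       (use rot n in auto)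
  have P_range: "(1 - q) * norm (P z) ^ 2 \<le> 2 * Re (P z)" if z: "z \<in> ball 0 1" for z
  proof -
    \<comment> \<open>convexity of \<open>(1 - q) * (norm w)^2 - 2 * Re w\<close>, with the Cauchy-Schwarz inequality for its
      quadratic part\<close>
    have "norm (\<Sum>k<n. p (\<omega> ^ k * z)) ^ 2 \<le> (\<Sum>k<n. norm (p (\<omega> ^ k * z))) ^ 2"
      by (intro power_mono norm_sum) auto
    also have "\<dots> \<le> of_nat n * (\<Sum>k<n. norm (p (\<omega> ^ k * z)) ^ 2)"
      using sum_squared_le_sum_of_squares[of "\<lambda>k. norm (p (\<omega> ^ k * z))" "{..<n}"]
      by (simp add: mult.commute)
    finally have "(1 - q) * norm (\<Sum>k<n. p (\<omega> ^ k * z)) ^ 2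
        \<le> (1 - q) * (of_nat n * (\<Sum>k<n. norm (p (\<omega> ^ k * z)) ^ 2))"
      using q by (intro mult_left_mono) auto
    also have "\<dots> = of_nat n * (\<Sum>k<n. (1 - q) * norm (p (\<omega> ^ k * z)) ^ 2)"
      by (simp add: sum_distrib_left mult_ac)
    also have "\<dots> \<le> of_nat n * (\<Sum>k<n. 2 * Re (p (\<omega> ^ k * z)))"
      by (intro mult_left_mono sum_mono range rot z) auto
    also have "\<dots> = of_nat n * (2 * Re (\<Sum>k<n. p (\<omega> ^ k * z)))"
      by (simp add: sum_distrib_left)
    finally have "(1 - q) * norm (\<Sum>k<n. p (\<omega> ^ k * z)) ^ 2 / of_nat n ^ 2
        \<le> of_nat n * (2 * Re (\<Sum>k<n. p (\<omega> ^ k * z))) / of_nat n ^ 2"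
      by (rule divide_right_mono) simp
    then show ?thesis
      using n by (simp add: P_def norm_divide power_divide) (simp add: power2_eq_square)
  qed
  have A: "p has_fps_expansion A"
    unfolding A_def using holo by (intro has_fps_expansion_fps_expansion[of "ball 0 1"]) auto
  have "(\<lambda>z. inverse (of_nat n) * (\<Sum>k<n. (p \<circ> (\<lambda>z. \<omega> ^ k * z)) z)) has_fps_expansion
      fps_const (inverse (of_nat n)) * (\<Sum>k<n. fps_compose A (fps_const (\<omega> ^ k) * fps_X))"
    by (intro fps_expansion_intros A) auto
  also have "fps_const (inverse (of_nat n)) * (\<Sum>k<n. fps_compose A (fps_const (\<omega> ^ k) * fps_X)) = B"
  proof (rule fps_ext)
    fix j
    have "fps_nth (fps_const (inverse (of_nat n)) * (\<Sum>k<n. fps_compose A (fps_const (\<omega> ^ k) * fps_X))) j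
        = (\<Sum>k<n. (\<omega> ^ k) ^ j) / of_nat n * fps_nth A j"
      by (simp add: fps_sum_nth divide_inverse flip: sum_distrib_right)
    also have "\<dots> = fps_nth B j"
      using roots_of_unity_average[OF n, of j] by (simp add: B_def \<omega>_def)
    finally show "fps_nth (fps_const (inverse (of_nat n)) *
        (\<Sum>k<n. fps_compose A (fps_const (\<omega> ^ k) * fps_X))) j = fps_nth B j" .
  qed
  also have "(\<lambda>z. inverse (of_nat n) * (\<Sum>k<n. (p \<circ> (\<lambda>z. \<omega> ^ k * z)) z)) = P"
    by (simp add: P_def field_simps)
  finally have B: "P has_fps_expansion B" .
  have B0: "fps_nth B 0 = 1"
    using p0 by (simp add: A_def B_def fps_expansion_def)
  define W where "W = (\<lambda>z. (P z - 1) / (of_real q * P z + 1))"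
  have key: "norm (P z - 1) \<le> norm (of_real q * P z + 1)" "of_real q * P z + 1 \<noteq> 0"
    if z: "z \<in> ball 0 1" for z
  proof -
    have "norm (of_real q * P z + 1) ^ 2 - norm (P z - 1) ^ 2
        = (1 + q) * (2 * Re (P z) - (1 - q) * norm (P z) ^ 2)"
      unfolding cmod_power2 by (simp add: power2_eq_square algebra_simps)
    also have "\<dots> \<ge> 0"
      using P_range[OF z] q by simp
    finally show "norm (P z - 1) \<le> norm (of_real q * P z + 1)"
      by (simp add: power2_le_iff_abs_le)
    have "0 \<le> (1 - q) * norm (P z) ^ 2"
      using q by simp
    with P_range[OF z] have "Re (P z) \<ge> 0"
      by linarith
    then have "Re (of_real q * P z + 1) > 0"
      using q by (simp add: add_nonneg_pos)
    then show "of_real q * P z + 1 \<noteq> 0"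
      by (metis less_irrefl zero_complex.simps(1))
  qed
  have W_holo: "W holomorphic_on ball 0 1"
    unfolding W_def by (intro holomorphic_intros P_holo key)
  have W_bound: "norm (W z) \<le> 1" if "z \<in> ball 0 1" for z
    using key[OF that] by (simp add: W_def norm_divide)
  define C where "C = fps_expansion W 0"
  have P1: "P 0 = 1"
    using p0 n by (simp add: P_def)
  have C0: "fps_nth C 0 = 0"
    by (simp add: C_def fps_expansion_def W_def P1)
  have "fps_expansion (\<lambda>z. P z - 1) 0 = fps_expansion (\<lambda>z. of_real q * P z + 1) 0 * C"
    unfolding C_def
    by (rule fps_expansion_mult_eq) (use key(2) in \<open>auto intro!: holomorphic_intros P_holo W_holo simp: W_def\<close>)
  moreover have "fps_expansion (\<lambda>z. P z - 1) 0 = B - 1"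
    by (intro fps_expansion_eqI fps_expansion_intros B)
  moreover have "fps_expansion (\<lambda>z. of_real q * P z + 1) 0 = fps_const (of_real q) * B + 1"
    by (intro fps_expansion_eqI fps_expansion_intros B)
  ultimately have "(fps_const (of_real q) * B + 1) * C = B - 1"
    by simp
  \<comment> \<open>In the \<open>n\<close>-th coefficient only the first term of the Cauchy product survives: the coefficients
    \<open>0 < i < n\<close> of \<open>B\<close> vanish, and \<open>C\<^sub>0 = 0\<close> kills \<open>i = n\<close>.\<close>
  then have "fps_nth ((fps_const (of_real q) * B + 1) * C) n = fps_nth (B - 1) n"
    by simp
  also have "fps_nth (B - 1) n = fps_nth A n"
    using n by (simp add: B_def)
  also have "fps_nth ((fps_const (of_real q) * B + 1) * C) n
      = (\<Sum>i=0..n. fps_nth (fps_const (of_real q) * B + 1) i * fps_nth C (n - i))"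
    by (rule fps_mult_nth)
  also have "\<dots> = (\<Sum>i\<in>{0}. fps_nth (fps_const (of_real q) * B + 1) i * fps_nth C (n - i))"
  proof (intro sum.mono_neutral_right ballI)
    fix i assume i: "i \<in> {0..n} - {0}"
    show "fps_nth (fps_const (of_real q) * B + 1) i * fps_nth C (n - i) = 0"
    proof (cases "i = n")
      case False
      then have "\<not> n dvd i"
        using i by (auto dest: dvd_imp_le)
      then show ?thesis
        using i by (simp add: B_def)
    qed (simp add: C0)
  qed auto
  also have "\<dots> = (1 + of_real q) * fps_nth C n"
    by (simp add: B0)
  finally have "norm (fps_nth A n) = norm ((1 + of_real q) * fps_nth C n)"
    by simp
  also have "\<dots> = (1 + q) * norm (fps_nth C n)"
    using norm_of_real[of "1 + q", where 'a = complex] q by (simp add: norm_mult)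
  also have "\<dots> \<le> (1 + q) * 1"
    unfolding C_def using q by (intro mult_left_mono fps_coeff_le_1_if_bounded_by_1 W_holo W_bound) auto
  finally show ?thesis
    by (simp add: A_def)
qed

section \<open>Starlike functions\<close>

text \<open>
  By starlikeness \<open>u \<mapsto> g\<^sup>-\<^sup>1 (t * g u)\<close> is for each \<open>t \<in> {0..1}\<close> a self-map of the disc that
  fixes \<open>0\<close>, so by the Schwarz lemma the curve \<open>t \<mapsto> g\<^sup>-\<^sup>1 (t * g z)\<close> stays in the disc of radius
  \<open>norm z\<close> until it reaches \<open>z\<close> at \<open>t = 1\<close>. Its velocity there is \<open>g z / deriv g z\<close>, whose
  component in the direction of \<open>z\<close> therefore cannot be negative. The conclusion is equivalent to
  \<open>0 \<le> Re (z * deriv g z / g z)\<close> for \<open>z \<noteq> 0\<close>.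
\<close>

lemma starlike_Re_nonneg:
  assumes holo: "g holomorphic_on ball 0 1" and g0: "g 0 = 0"
    and inj: "inj_on g (ball 0 1)" and star: "starlike_wrt_origin (g ` ball 0 1)"
    and z: "z \<in> ball 0 1"
  shows "deriv g z \<noteq> 0" "0 \<le> Re (cnj z * (g z / deriv g z))"
proof -
  obtain k where k: "k holomorphic_on g ` ball 0 1"
      "\<And>z. z \<in> ball 0 1 \<Longrightarrow> deriv g z * deriv k (g z) = 1"
      "\<And>z. z \<in> ball 0 1 \<Longrightarrow> k (g z) = z"
    using holomorphic_has_inverse[OF holo _ inj] by auto
  show nz: "deriv g z \<noteq> 0"
    using k(2)[OF z] by auto
  define w where "w = (\<lambda>t::real. k (of_real t * g z))"
  have w_le: "norm (w t) \<le> norm z" if t: "t \<in> {0..1}" for t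
  proof -
    have mem: "of_real t * g u \<in> g ` ball 0 1" if "u \<in> ball 0 1" for u
      using star that t unfolding starlike_wrt_origin_def by blast
    show ?thesis unfolding w_def
    proof (rule Schwarz_Lemma(1)[where f = "\<lambda>u. k (of_real t * g u)"])
      show "(\<lambda>u. k (of_real t * g u)) holomorphic_on ball 0 1"
        using mem by (intro holomorphic_on_compose_gen[OF _ k(1), unfolded o_def] holomorphic_intros holo) auto
      show "k (of_real t * g 0) = 0"
        using k(3)[of 0] g0 by simp
      show "norm (k (of_real t * g u)) < 1" if "norm u < 1" for u
        using mem[of u] that k(3) by fastforce
    qed (use z in auto)
  qed
  have "open (g ` ball 0 1)"
    using open_mapping_thm3[OF holo _ inj] by simp
  then have "(k has_field_derivative deriv k (g z)) (at (of_real 1 * g z))"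
    using holomorphic_derivI[OF k(1), of "g z"] z by auto
  moreover have "((\<lambda>t::real. of_real t * g z) has_vector_derivative g z) (at 1)"
    by (auto intro!: derivative_eq_intros)
  ultimately have "((k \<circ> (\<lambda>t::real. of_real t * g z)) has_vector_derivative g z * deriv k (g z)) (at 1)"
    by (intro field_vector_diff_chain_at)
  moreover have "g z * deriv k (g z) = g z / deriv g z"
    using k(2)[OF z] nz by (simp add: field_simps)
  ultimately have "(w has_vector_derivative g z / deriv g z) (at 1)"
    by (simp add: w_def o_def)
  then have "((\<lambda>t. Re (cnj z * w t)) has_vector_derivative Re (cnj z * (g z / deriv g z))) (at 1)"
    by (intro bounded_linear.has_vector_derivative[OF bounded_linear_Re]
        bounded_linear.has_vector_derivative[OF bounded_linear_mult_right])
  then have D: "DERIV (\<lambda>t. Re (cnj z * w t)) 1 :> Re (cnj z * (g z / deriv g z))"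
    by (simp add: has_real_derivative_iff_has_vector_derivative)
  show "0 \<le> Re (cnj z * (g z / deriv g z))"
  proof (rule ccontr)
    assume "\<not> ?thesis"
    then obtain d where d: "d > 0" "\<And>h. h > 0 \<Longrightarrow> h < d \<Longrightarrow>
        Re (cnj z * w 1) < Re (cnj z * w (1 - h))"
      using DERIV_neg_dec_left[OF D] by auto
    define h where "h = min (d / 2) 1"
    have h: "h > 0" "h < d" "h \<le> 1"
      using d(1) by (auto simp: h_def)
    have "Re (cnj z * w (1 - h)) \<le> norm (cnj z * w (1 - h))"
      by (rule complex_Re_le_cmod)
    also have "\<dots> \<le> norm z * norm z"
      using h w_le[of "1 - h"] by (auto simp: norm_mult intro!: mult_left_mono)
    also have "\<dots> = Re (cnj z * w 1)"
      using k(3)[OF z] by (simp add: w_def cmod_power2 flip: power2_eq_square)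
    finally show False
      using d(2)[OF h(1,2)] by simp
  qed
qed

text \<open>
  \<open>id_over g\<close> is the reciprocal of the difference quotient of \<open>g\<close> at \<open>0\<close>, which has no zeros because
  \<open>g\<close> is injective and \<open>deriv g 0 = 1\<close>.
\<close>

lemma class_S_star_id_over:
  assumes g: "g \<in> class_S_star"
  shows "id_over g holomorphic_on ball 0 1"
    "\<And>z. z \<in> ball 0 1 \<Longrightarrow> z \<noteq> 0 \<Longrightarrow> g z \<noteq> 0"
    "\<And>z. z \<in> ball 0 1 \<Longrightarrow> g z * id_over g z = z"
proof -
  have holo: "g holomorphic_on ball 0 1" and g0: "g 0 = 0" and d: "deriv g 0 = 1"
    and inj: "inj_on g (ball 0 1)"
    using g by (auto simp: class_S_star_def class_A_def analytic_imp_holomorphic)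
  show nz: "g z \<noteq> 0" if "z \<in> ball 0 1" "z \<noteq> 0" for z
    using inj_onD[OF inj, of z 0] that by (auto simp: g0)
  then show "g z * id_over g z = z" if "z \<in> ball 0 1" for z
    using that by (auto simp: id_over_def g0)
  have "(\<lambda>z. if z = 0 then deriv g 0 else (g z - g 0) / (z - 0)) holomorphic_on ball 0 1"
    by (rule pole_lemma_open[OF holo open_ball])
  then have "(\<lambda>z. inverse (if z = 0 then deriv g 0 else (g z - g 0) / (z - 0))) holomorphic_on ball 0 1"
    by (rule holomorphic_on_inverse) (use nz in \<open>auto simp: d g0\<close>)
  also have "(\<lambda>z. inverse (if z = 0 then deriv g 0 else (g z - g 0) / (z - 0))) = id_over g"
    by (auto simp: id_over_def fun_eq_iff d g0)
  finally show "id_over g holomorphic_on ball 0 1" .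
qed

text \<open>
  With \<open>p z = z * deriv g z / g z\<close>, of nonnegative real part, the identity \<open>z * deriv g z = g z * p z\<close>
  reads \<open>(n - 1) * b\<^sub>n = (\<Sum>k<n. b\<^sub>k * p\<^sub>n\<^sub>-\<^sub>k)\<close> on coefficients. With \<open>norm p\<^sub>m \<le> 2\<close> and
  the induction hypothesis, the right-hand side is at most \<open>2 * (\<Sum>k<n. k) = (n - 1) * n\<close>.
\<close>

lemma class_S_star_coeff_bound:
  assumes g: "g \<in> class_S_star"
  shows "norm (fps_nth (fps_expansion g 0) n) \<le> real n"
proof -
  have holo: "g holomorphic_on ball 0 1" and g0: "g 0 = 0" and d: "deriv g 0 = 1"
    and inj: "inj_on g (ball 0 1)" and star: "starlike_wrt_origin (g ` ball 0 1)"
    using g by (auto simp: class_S_star_def class_A_def analytic_imp_holomorphic)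
  define p where "p = (\<lambda>z. id_over g z * deriv g z)"
  have p_holo: "p holomorphic_on ball 0 1"
    unfolding p_def by (intro holomorphic_intros holo class_S_star_id_over g) auto
  have p0: "p 0 = 1"
    by (simp add: p_def id_over_def d)
  have p_Re: "0 \<le> Re (p z)" if z: "z \<in> ball 0 1" for z
  proof (cases "z = 0")
    case False
    define u where "u = cnj z * (g z / deriv g z)"
    have nz: "deriv g z \<noteq> 0" "g z \<noteq> 0" and u: "0 \<le> Re u"
      using starlike_Re_nonneg[OF holo g0 inj star z] class_S_star_id_over(2)[OF g z] False by (auto simp: u_def)
    have "p z = z * cnj z / u"
      using False nz by (simp add: p_def id_over_def u_def)
    also have "\<dots> = of_real (norm z ^ 2) / u"
      by (simp only: complex_norm_square)
    also have "Re \<dots> = norm z ^ 2 * Re u / norm u ^ 2"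
      by (simp add: Re_divide cmod_power2)
    finally show ?thesis
      using u by simp
  qed (simp add: p0)
  define G where "G = fps_expansion g 0"
  define P where "P = fps_expansion p 0"
  have P_bound: "norm (fps_nth P m) \<le> 2" if "m > 0" for m
    using fps_coeff_bound_subordinate[of 1 p m] p_holo p0 p_Re that by (simp add: P_def)
  have "fps_expansion (\<lambda>z. z * deriv g z) 0 = G * P"
    unfolding G_def P_def
    by (rule fps_expansion_mult_eq[OF holo p_holo])
       (simp add: p_def class_S_star_id_over(3)[OF g] flip: mult.assoc)
  moreover have "fps_expansion (\<lambda>z. z * deriv g z) 0 = fps_X * fps_deriv G"
    unfolding G_def using holo
    by (intro fps_expansion_eqI fps_expansion_intros has_fps_expansion_fps_expansion[of "ball 0 1"]) auto
  ultimately have "G * P = fps_X * fps_deriv G"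
    by simp
  then have GP: "fps_nth (G * P) m = of_nat m * fps_nth G m" for m
    by (cases m) auto
  have "norm (fps_nth G n) \<le> real n"
  proof (induction n rule: less_induct)
    case (less n)
    have "norm (fps_nth (G * P) n - fps_nth G n) \<le> 2 * (real n * (real n - 1) / 2)"
      using less by (intro fps_mult_coeff_bound P_bound) (auto simp: P_def fps_expansion_def p0)
    moreover have "fps_nth (G * P) n - fps_nth G n = of_real (real n - 1) * fps_nth G n"
      by (simp add: GP algebra_simps)
    ultimately have *: "\<bar>real n - 1\<bar> * norm (fps_nth G n) \<le> (real n - 1) * real n"
      by (simp add: norm_mult mult.commute del: of_real_diff)
    consider "n = 0" | "n = 1" | "n \<ge> 2"
      by linarith
    then show ?case
    proof cases
      case 3
      then show ?thesis
        using * by simp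
    qed (simp_all add: G_def fps_expansion_def g0 d)
  qed
  then show ?thesis
    by (simp add: G_def)
qed

section \<open>The q-difference operator and the coefficient bound\<close>

text \<open>
  The operator is the difference quotient at \<open>0\<close> of \<open>\<phi> z = (f z - f (q * z)) / (1 - q)\<close>, and
  \<open>deriv \<phi> 0 = deriv f 0\<close> is the value that removes the singularity.
\<close>

lemma q_difference_holomorphic:
  assumes q: "0 < q" "q < 1" and holo: "f holomorphic_on ball 0 1"
  shows "q_difference q f holomorphic_on ball 0 1"
proof -
  define \<phi> where "\<phi> = (\<lambda>z. (f z - f (of_real q * z)) / (1 - of_real q))"
  have ball: "of_real q * z \<in> ball 0 1" if "z \<in> ball 0 1" for z :: complex
    using that q mult_strict_mono[of q 1 "norm z" 1] by (simp add: norm_mult)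
  have [simp]: "q \<noteq> 1" "1 \<noteq> complex_of_real q"
    using q by (auto simp: complex_eq_iff)
  have "\<phi> holomorphic_on ball 0 1"
    unfolding \<phi>_def
    by (intro holomorphic_intros holo holomorphic_on_compose_gen[OF _ holo, unfolded o_def])
       (use ball in auto)
  then have "(\<lambda>z. if z = 0 then deriv \<phi> 0 else (\<phi> z - \<phi> 0) / (z - 0)) holomorphic_on ball 0 1"
    by (rule pole_lemma_open) simp
  moreover have "deriv \<phi> 0 = deriv f 0"
  proof -
    have f': "(f has_field_derivative deriv f 0) (at 0)"
      using holomorphic_derivI[OF holo, of 0] by auto
    have "((\<lambda>z. f (of_real q * z)) has_field_derivative deriv f 0 * of_real q) (at 0)"
      by (rule DERIV_chain2[where f = f]) (use f' in \<open>auto intro!: derivative_eq_intros\<close>)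
    then have "(\<phi> has_field_derivative (deriv f 0 - deriv f 0 * of_real q) / (1 - of_real q)) (at 0)"
      unfolding \<phi>_def by (intro DERIV_cdivide DERIV_diff f')
    then show ?thesis
      by (simp add: DERIV_imp_deriv field_simps)
  qed
  moreover have "q_difference q f = (\<lambda>z. if z = 0 then deriv f 0 else (\<phi> z - \<phi> 0) / (z - 0))"
    by (auto simp: q_difference_def \<phi>_def fun_eq_iff mult.commute)
  ultimately show ?thesis
    by (simp only:)
qed

theorem theorem3p2:
  fixes q :: real and f :: "complex \<Rightarrow> complex" and a :: "nat \<Rightarrow> complex"
  assumes "0 < q" and "q < 1"
    and "f \<in> class_K q"
    and "\<And>z. z \<in> ball 0 1 \<Longrightarrow> (\<lambda>n. a (n + 2) * z ^ (n + 2)) sums (f z - z)"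
  shows "\<forall>n\<ge>2. norm (a n) \<le>
           (1 - q) / (1 - q ^ n) * (real n + real n * (real n - 1) / 2 * (1 + q))"
proof (intro allI impI)
  fix n :: nat assume n: "n \<ge> 2"
  note q = assms(1,2)
  obtain g where g: "g \<in> class_S_star" and close: "\<And>z. z \<in> ball 0 1 \<Longrightarrow>
      norm (id_over g z * q_difference q f z - 1 / (1 - of_real q)) \<le> 1 / (1 - q)"
    using assms(3) unfolding class_K_def by blast
  have f_holo: "f holomorphic_on ball 0 1" and f1: "deriv f 0 = 1"
    using assms(3) by (auto simp: class_K_def class_A_def analytic_imp_holomorphic)
  have g_holo: "g holomorphic_on ball 0 1" and g0: "g 0 = 0"
    using g by (auto simp: class_S_star_def class_A_def analytic_imp_holomorphic)
  define p where "p = (\<lambda>z. id_over g z * q_difference q f z)"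
  have p_holo: "p holomorphic_on ball 0 1"
    unfolding p_def by (intro holomorphic_intros class_S_star_id_over g q_difference_holomorphic q f_holo)
  have p0: "p 0 = 1"
    by (simp add: p_def id_over_def q_difference_def f1)
  have range: "(1 - q) * norm (p z) ^ 2 \<le> 2 * Re (p z)" if "z \<in> ball 0 1" for z
  proof -
    \<comment> \<open>the disc of centre and radius \<open>R\<close> as the quadratic condition \<open>(norm w)^2 \<le> 2 * R * Re w\<close>\<close>
    define R where "R = 1 / (1 - q)"
    have "norm (p z - of_real R) \<le> R"
      using close[OF that] by (simp add: p_def R_def)
    then have "norm (p z - of_real R) ^ 2 \<le> R ^ 2"
      by (intro power_mono) auto
    then have "norm (p z) ^ 2 \<le> 2 * R * Re (p z)"
      unfolding cmod_power2 by (simp add: power2_eq_square algebra_simps)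
    then have "(1 - q) * norm (p z) ^ 2 \<le> (1 - q) * (2 * R * Re (p z))"
      using q by (intro mult_left_mono) auto
    then show ?thesis
      using q by (simp add: R_def)
  qed
  define G where "G = fps_expansion g 0"
  define P where "P = fps_expansion p 0"
  \<comment> \<open>The hypothesis on \<open>a\<close> leaves \<open>a 0\<close> and \<open>a 1\<close> arbitrary; the true coefficients are \<open>0\<close> and \<open>1\<close>.\<close>
  define A where "A = Abs_fps (\<lambda>n. if n = 0 then 0 else if n = 1 then 1 else a n)"
  have A: "f has_fps_expansion A"
    unfolding A_def
  proof (rule has_fps_expansion_if_sums)
    fix z :: complex assume "z \<in> ball 0 1"
    from assms(4)[OF this]
    show "(\<lambda>n. (if n = 0 then 0 else if n = 1 then 1 else a n) * z ^ n) sums f z"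
      using sums_iff_shift[of "\<lambda>n. (if n = 0 then 0 else if n = 1 then 1 else a n) * z ^ n" 2 "f z - z"]
      by (simp add: numeral_2_eq_2)
  qed
  have [simp]: "q \<noteq> 1" "1 \<noteq> complex_of_real q"
    using q by (auto simp: complex_eq_iff)
  \<comment> \<open>The two expansions of \<open>z * q_difference q f z\<close>: as the product of \<open>g\<close> and \<open>p\<close>, and
    coefficientwise from that of \<open>f\<close>.\<close>
  have "fps_expansion (\<lambda>z. inverse (1 - of_real q) * (f z - (f \<circ> (\<lambda>z. of_real q * z)) z)) 0 = G * P"
    unfolding G_def P_def
  proof (rule fps_expansion_mult_eq[OF g_holo p_holo])
    fix z :: complex assume z: "z \<in> ball 0 1"
    show "inverse (1 - of_real q) * (f z - (f \<circ> (\<lambda>z. of_real q * z)) z) = g z * p z"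
      using class_S_star_id_over(2)[OF g z] by (cases "z = 0") (auto simp: p_def id_over_def q_difference_def g0 field_simps)
  qed
  moreover have "fps_expansion (\<lambda>z. inverse (1 - of_real q) * (f z - (f \<circ> (\<lambda>z. of_real q * z)) z)) 0
      = fps_const (inverse (1 - of_real q)) * (A - fps_compose A (fps_const (of_real q) * fps_X))"
    by (intro fps_expansion_eqI fps_expansion_intros A) auto
  ultimately have GP: "G * P
      = fps_const (inverse (1 - of_real q)) * (A - fps_compose A (fps_const (of_real q) * fps_X))"
    by simp
  have "fps_nth (G * P) n = of_real ((1 - q ^ n) / (1 - q)) * a n"
    unfolding GP fps_compose_linear using n by (simp add: A_def divide_inverse algebra_simps)
  then have "(1 - q ^ n) / (1 - q) * norm (a n) = norm (fps_nth (G * P) n)"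
    using q by (simp add: norm_mult power_le_one del: of_real_divide of_real_diff)
  also have "\<dots> \<le> norm (fps_nth G n) + norm (fps_nth (G * P) n - fps_nth G n)"
    by (rule norm_triangle_sub)
  also have "\<dots> \<le> real n + (1 + q) * (real n * (real n - 1) / 2)"
    unfolding G_def P_def
    by (intro add_mono fps_mult_coeff_bound class_S_star_coeff_bound g
        fps_coeff_bound_subordinate p_holo p0 range)
       (use q in \<open>auto simp: fps_expansion_def p0\<close>)
  finally have "(1 - q ^ n) / (1 - q) * norm (a n) \<le> \<dots>" .
  moreover have "q ^ n < 1"
    using q n by (simp add: power_less_one_iff)
  ultimately show "norm (a n) \<le> (1 - q) / (1 - q ^ n) * (real n + real n * (real n - 1) / 2 * (1 + q))"
    using q by (simp add: field_simps)
qed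

end
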